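(* A group is residually finite if and only if it has a semi-conjugacy-separating family of finite-index subgroups.
   Context: A family $\sigma$ of finite-index subgroups of a group $G$ is separating if for any non-empty finite subset $F\subset G\setminus\{1\}$ there is $G_\alpha\in\sigma$ such that $g\notin G_\alpha$ for every $g\in F$. $G$ is residually finite if it has a separating family of finite-index subgroups (equivalently, the family of all its finite-index subgroups is separating). The family $\sigma$ is semi-conjugacy-separating if for every non-empty finite subset $F\subset G$ there is $G_\alpha\in\sigma$ such that $G_\alpha\cap g^G G_\alpha=\varnothing$ for every $g\in F\setminus\{1\}$, where $g^G$ is the conjugacy class of $g$. *)

theory Defs
  imports "HOL-Algebra.Coset"
begin

(* The index is required to be finite through the set of right cosets itself, since
   card (and hence a numerical index) is 0 on infinite sets. *)
definition finite_index_subgroups :: "('a, 'b) monoid_scheme \<Rightarrow> 'a set set"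
  where "finite_index_subgroups G = {H. subgroup H G \<and> finite (rcosets\<^bsub>G\<^esub> H)}"

definition separating :: "('a, 'b) monoid_scheme \<Rightarrow> 'a set set \<Rightarrow> bool"
  where "separating G \<sigma> \<longleftrightarrow>
    (\<forall>F. finite F \<and> F \<noteq> {} \<and> F \<subseteq> carrier G - {\<one>\<^bsub>G\<^esub>} \<longrightarrow>
      (\<exists>H\<in>\<sigma>. \<forall>g\<in>F. g \<notin> H))"

definition residually_finite :: "('a, 'b) monoid_scheme \<Rightarrow> bool"
  where "residually_finite G \<longleftrightarrow>
    (\<exists>\<sigma>. \<sigma> \<subseteq> finite_index_subgroups G \<and> separating G \<sigma>)"

definition conjugacy_class :: "('a, 'b) monoid_scheme \<Rightarrow> 'a \<Rightarrow> 'a set"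
  where "conjugacy_class G g = {inv\<^bsub>G\<^esub> x \<otimes>\<^bsub>G\<^esub> g \<otimes>\<^bsub>G\<^esub> x | x. x \<in> carrier G}"

definition semi_conjugacy_separating :: "('a, 'b) monoid_scheme \<Rightarrow> 'a set set \<Rightarrow> bool"
  where "semi_conjugacy_separating G \<sigma> \<longleftrightarrow>
    (\<forall>F. finite F \<and> F \<noteq> {} \<and> F \<subseteq> carrier G \<longrightarrow>
      (\<exists>H\<in>\<sigma>. \<forall>g\<in>F - {\<one>\<^bsub>G\<^esub>}. H \<inter> (conjugacy_class G g <#>\<^bsub>G\<^esub> H) = {}))"

end

theory Submission
  imports Defs
begin

text \<open>
  A normal subgroup \<open>N\<close> meets \<open>g\<^sup>G N\<close> only if \<open>g \<in> N\<close>, so for normal subgroups both separation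
  conditions say the same. Every finite-index subgroup contains a normal one of finite index,
  namely the kernel of the action on its right cosets.
\<close>

definition coset_kernel :: "('a, 'b) monoid_scheme \<Rightarrow> 'a set \<Rightarrow> 'a set"
  where "coset_kernel G H = {n \<in> carrier G. \<forall>C\<in>rcosets\<^bsub>G\<^esub> H. C #>\<^bsub>G\<^esub> n = C}"

lemma finite_image_factor:
  assumes "finite (p ` A)" and "\<And>a b. a \<in> A \<Longrightarrow> b \<in> A \<Longrightarrow> p a = p b \<Longrightarrow> f a = f b"
  shows "finite (f ` A)"
proof (rule finite_subset)
  show "f ` A \<subseteq> (\<lambda>y. f (inv_into A p y)) ` p ` A"
  proof clarify
    fix a assume a: "a \<in> A"
    have "inv_into A p (p a) \<in> A" "p (inv_into A p (p a)) = p a"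
      using a by (simp_all add: inv_into_into f_inv_into_f)
    then have "f a = f (inv_into A p (p a))"
      using assms(2) a by metis
    then show "f a \<in> (\<lambda>y. f (inv_into A p y)) ` p ` A"
      using a by blast
  qed
qed (use assms(1) in blast)

context group
begin

context
  fixes H assumes H: "subgroup H G"
begin

lemma rcoset_subset: "C \<in> rcosets H \<Longrightarrow> C \<subseteq> carrier G"
  using rcosets_subset_PowG[OF H] by blast

lemma rcoset_translate:
  assumes "C \<in> rcosets H" "a \<in> carrier G"
  shows "C #> a \<in> rcosets H"
  using assms subgroup.subset[OF H]
  by (auto simp: RCOSETS_def coset_mult_assoc)

lemma coset_kernelI:
  assumes "n \<in> carrier G" "\<And>C. C \<in> rcosets H \<Longrightarrow> C #> n = C"
  shows "n \<in> coset_kernel G H"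
  using assms by (simp add: coset_kernel_def)

lemma coset_kernel_carrier: "n \<in> coset_kernel G H \<Longrightarrow> n \<in> carrier G"
  by (simp add: coset_kernel_def)

lemma coset_kernel_fixes: "n \<in> coset_kernel G H \<Longrightarrow> C \<in> rcosets H \<Longrightarrow> C #> n = C"
  by (simp add: coset_kernel_def)

lemma coset_kernel_subset: "coset_kernel G H \<subseteq> H"
proof
  fix n assume n: "n \<in> coset_kernel G H"
  have "H \<in> rcosets H"
    using subgroup.subgroup_in_rcosets[OF H is_group] .
  then have "H #> n = H"
    using coset_kernel_fixes n by blast
  then show "n \<in> H"
    using coset_join1[OF _ coset_kernel_carrier[OF n] H] by blast
qed

lemma coset_kernel_normal: "coset_kernel G H \<lhd> G"
proof (rule normal_invI)
  show "subgroup (coset_kernel G H) G"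
  proof (rule subgroupI)
    have "\<one> \<in> coset_kernel G H"
      by (rule coset_kernelI) (simp_all add: rcoset_subset)
    then show "coset_kernel G H \<noteq> {}" by blast
  next
    fix a assume a: "a \<in> coset_kernel G H"
    note ac = coset_kernel_carrier[OF a]
    show "inv a \<in> coset_kernel G H"
    proof (rule coset_kernelI)
      fix C assume C: "C \<in> rcosets H"
      have "C #> inv a = C #> a #> inv a"
        using coset_kernel_fixes[OF a C] by simp
      also have "\<dots> = C"
        using ac rcoset_subset[OF C] by (simp add: coset_mult_assoc)
      finally show "C #> inv a = C" .
    qed (use ac in simp)
  next
    fix a b assume ab: "a \<in> coset_kernel G H" "b \<in> coset_kernel G H"
    then show "a \<otimes> b \<in> coset_kernel G H"
      by (intro coset_kernelI)
        (simp_all add: coset_kernel_carrier coset_mult_assoc[symmetric] rcoset_subset coset_kernel_fixes)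
  qed (rule subsetI, erule coset_kernel_carrier)
next
  fix x n assume x: "x \<in> carrier G" and n: "n \<in> coset_kernel G H"
  note nc = coset_kernel_carrier[OF n]
  show "x \<otimes> n \<otimes> inv x \<in> coset_kernel G H"
  proof (rule coset_kernelI)
    fix C assume C: "C \<in> rcosets H"
    have "C #> (x \<otimes> n \<otimes> inv x) = C #> x #> n #> inv x"
      using x nc rcoset_subset[OF C] by (simp add: coset_mult_assoc r_coset_subset_G m_assoc)
    also have "\<dots> = C #> x #> inv x"
      using coset_kernel_fixes[OF n rcoset_translate[OF C x]] by simp
    also have "\<dots> = C"
      using x rcoset_subset[OF C] by (simp add: coset_mult_assoc)
    finally show "C #> (x \<otimes> n \<otimes> inv x) = C" .
  qed (use x nc in simp)
qed

lemma finite_rcosets_coset_kernel: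
  assumes fin: "finite (rcosets H)"
  shows "finite (rcosets (coset_kernel G H))"
proof -
  define p where "p a = restrict (\<lambda>C. C #> a) (rcosets H)" for a
  have "p ` carrier G \<subseteq> rcosets H \<rightarrow>\<^sub>E rcosets H"
    by (auto simp: p_def rcoset_translate)
  then have "finite (p ` carrier G)"
    using fin by (meson finite_PiE finite_subset)
  moreover have "coset_kernel G H #> a = coset_kernel G H #> b"
    if ab: "a \<in> carrier G" "b \<in> carrier G" and eq: "p a = p b" for a b
  proof (rule coset_mult_inv1)
    have "a \<otimes> inv b \<in> coset_kernel G H"
    proof (rule coset_kernelI)
      fix C assume C: "C \<in> rcosets H"
      have "C #> a = C #> b"
        using fun_cong[OF eq, of C] C by (simp add: p_def)
      then have "C #> (a \<otimes> inv b) = C #> b #> inv b"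
        using ab rcoset_subset[OF C] by (metis coset_mult_assoc inv_closed)
      then show "C #> (a \<otimes> inv b) = C"
        using ab rcoset_subset[OF C] by (simp add: coset_mult_assoc)
    qed (use ab in simp)
    then show "coset_kernel G H #> (a \<otimes> inv b) = coset_kernel G H"
      using coset_join2 ab normal_imp_subgroup[OF coset_kernel_normal] by simp
  qed (use ab coset_kernel_carrier in auto)
  ultimately have "finite ((\<lambda>a. coset_kernel G H #> a) ` carrier G)"
    by (rule finite_image_factor)
  then show ?thesis
    by (simp add: RCOSETS_def UNION_singleton_eq_range)
qed

end

lemma carrier_in_finite_index_subgroups: "carrier G \<in> finite_index_subgroups G"
proof -
  have "rcosets (carrier G) \<subseteq> {carrier G}"
    by (auto simp: RCOSETS_def coset_join2 subgroup_self)
  then show ?thesis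
    by (auto simp: finite_index_subgroups_def subgroup_self intro: finite_subset)
qed

lemma normal_meets_conjugacy_class_mult:
  assumes N: "N \<lhd> G" and g: "g \<in> carrier G"
    and meets: "N \<inter> (conjugacy_class G g <#> N) \<noteq> {}"
  shows "g \<in> N"
proof -
  interpret N: normal N G by (rule N)
  obtain x m where x: "x \<in> carrier G" and m: "m \<in> N"
    and n: "inv x \<otimes> g \<otimes> x \<otimes> m \<in> N"
    using meets by (auto simp: set_mult_def conjugacy_class_def)
  have "inv x \<otimes> g \<otimes> x \<otimes> m \<otimes> inv m \<in> N"
    using n m by blast
  then have "inv x \<otimes> g \<otimes> x \<in> N"
    using x g m N.mem_carrier by (simp add: m_assoc)
  then have "x \<otimes> (inv x \<otimes> g \<otimes> x) \<otimes> inv x \<in> N"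
    using x by (rule N.inv_op_closed2[rotated])
  also have "x \<otimes> (inv x \<otimes> g \<otimes> x) \<otimes> inv x = g"
    using x g by (simp add: inv_solve_right' m_assoc[symmetric])
  finally show ?thesis .
qed

lemma subgroup_meets_conjugacy_class_mult:
  assumes "subgroup H G" "g \<in> H"
  shows "H \<inter> (conjugacy_class G g <#> H) \<noteq> {}"
proof -
  have g: "g \<in> carrier G"
    using assms subgroup.mem_carrier by metis
  then have "g = inv \<one> \<otimes> g \<otimes> \<one>"
    by simp
  then have "g \<in> conjugacy_class G g"
    unfolding conjugacy_class_def by blast
  moreover have "g = g \<otimes> \<one>" using g by simp
  ultimately have "g \<in> conjugacy_class G g <#> H"
    using subgroup.one_closed[OF assms(1)] unfolding set_mult_def by blast
  then show ?thesis using assms(2) by blast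
qed

lemma separating_imp_semi_conjugacy_separating:
  assumes \<sigma>: "\<sigma> \<subseteq> finite_index_subgroups G" and sep: "separating G \<sigma>"
  shows "semi_conjugacy_separating G (finite_index_subgroups G)"
  unfolding semi_conjugacy_separating_def
proof (intro allI impI)
  fix F assume F: "finite F \<and> F \<noteq> {} \<and> F \<subseteq> carrier G"
  show "\<exists>H\<in>finite_index_subgroups G. \<forall>g\<in>F - {\<one>}. H \<inter> (conjugacy_class G g <#> H) = {}"
  proof (cases "F - {\<one>} = {}")
    case True
    then show ?thesis
      using carrier_in_finite_index_subgroups by auto
  next
    case False
    then have "finite (F - {\<one>}) \<and> F - {\<one>} \<noteq> {} \<and> F - {\<one>} \<subseteq> carrier G - {\<one>}"
      using F by blast
    then obtain H where "H \<in> \<sigma>" and gH: "\<forall>g\<in>F - {\<one>}. g \<notin> H"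
      using sep unfolding separating_def by blast
    then have H: "subgroup H G" "finite (rcosets H)"
      using \<sigma> by (auto simp: finite_index_subgroups_def)
    let ?N = "coset_kernel G H"
    have "?N \<in> finite_index_subgroups G"
      using finite_rcosets_coset_kernel[OF H] normal_imp_subgroup[OF coset_kernel_normal[OF H(1)]]
      by (simp add: finite_index_subgroups_def)
    moreover have "?N \<inter> (conjugacy_class G g <#> ?N) = {}" if "g \<in> F - {\<one>}" for g
      using normal_meets_conjugacy_class_mult[OF coset_kernel_normal[OF H(1)], of g]
        coset_kernel_subset[OF H(1)] gH that F by blast
    ultimately show ?thesis by blast
  qed
qed

lemma semi_conjugacy_separating_imp_separating:
  assumes \<sigma>: "\<And>H. H \<in> \<sigma> \<Longrightarrow> subgroup H G" and sep: "semi_conjugacy_separating G \<sigma>"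
  shows "separating G \<sigma>"
  unfolding separating_def
proof (intro allI impI)
  fix F assume F: "finite F \<and> F \<noteq> {} \<and> F \<subseteq> carrier G - {\<one>}"
  then obtain H where "H \<in> \<sigma>" "\<forall>g\<in>F - {\<one>}. H \<inter> (conjugacy_class G g <#> H) = {}"
    using sep unfolding semi_conjugacy_separating_def by blast
  then have "\<forall>g\<in>F. g \<notin> H"
    using F \<sigma> subgroup_meets_conjugacy_class_mult[of H] by blast
  then show "\<exists>H\<in>\<sigma>. \<forall>g\<in>F. g \<notin> H"
    using \<open>H \<in> \<sigma>\<close> by blast
qed

end

theorem corollary3p14:
  fixes G :: "('a, 'b) monoid_scheme"
  assumes "group G"
  shows "residually_finite G \<longleftrightarrow>
    (\<exists>\<sigma>. \<sigma> \<subseteq> finite_index_subgroups G \<and> semi_conjugacy_separating G \<sigma>)"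
proof
  assume "residually_finite G"
  then show "\<exists>\<sigma>. \<sigma> \<subseteq> finite_index_subgroups G \<and> semi_conjugacy_separating G \<sigma>"
    using group.separating_imp_semi_conjugacy_separating[OF assms]
    unfolding residually_finite_def by blast
next
  assume "\<exists>\<sigma>. \<sigma> \<subseteq> finite_index_subgroups G \<and> semi_conjugacy_separating G \<sigma>"
  then obtain \<sigma> where \<sigma>: "\<sigma> \<subseteq> finite_index_subgroups G" "semi_conjugacy_separating G \<sigma>"
    by blast
  have "separating G \<sigma>"
    using \<sigma> by (intro group.semi_conjugacy_separating_imp_separating[OF assms])
      (auto simp: finite_index_subgroups_def)
  then show "residually_finite G"
    using \<sigma>(1) unfolding residually_finite_def by blast
qed

end
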